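(* Let $m=2k$ be an even positive integer ($k\ge 1$ an integer), let $\beta=k+1$, and let $$\mathcal{F}=\left\{\frac{p}{(k+1)^{n}} : n,p\in\mathbb{N}\cup\{0\}\right\}\cap(0,2).$$ Then every element $x\in\mathcal{F}$ has countably many expansions (i.e. $\mathcal{E}_{\beta,m}(x)$ has cardinality $\aleph_0$), while every $x\in(0,2)\setminus\mathcal{F}$ has uncountably many expansions (i.e. $\mathcal{E}_{\beta,m}(x)$ is uncountable).
   Context: For a positive integer $m$, a base $\beta\in(1,m+1]$ and $x\in[0,\frac{m}{\beta-1}]$, an expansion of $x$ is a sequence $(\varepsilon_i)_{i\ge1}\in\{0,1,\ldots,m\}^{\infty}$ (all infinite sequences of digits in $\{0,\ldots,m\}$) with $x=\sum_{i=1}^{\infty}\varepsilon_i\beta^{-i}$. The set of all expansions of $x$ is $$\mathcal{E}_{\beta,m}(x)=\left\{(\varepsilon_i)_{i=1}^{\infty}\in\{0,1,\ldots,m\}^{\infty} : x=\sum_{i=1}^{\infty}\frac{\varepsilon_i}{\beta^i}\right\}.$$ Here $\frac{m}{\beta-1}=2$. The number $k+1$ is the generalized golden ratio $\mathcal{G}(m)$ for $m=2k$. *)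

theory Defs
  imports Complex_Main "HOL-Library.Countable_Set" "HOL-Library.Equipollence"
begin

(* A digit sequence is indexed from 0: \<epsilon> i is the digit of weight \<beta>^-(i+1). *)
definition expansions :: "real \<Rightarrow> nat \<Rightarrow> real \<Rightarrow> (nat \<Rightarrow> nat) set" where
  "expansions \<beta> m x =
     {\<epsilon>. (\<forall>i. \<epsilon> i \<in> {0..m}) \<and> (\<lambda>i. real (\<epsilon> i) / \<beta> ^ Suc i) sums x}"

definition exceptional_set :: "nat \<Rightarrow> real set" where
  "exceptional_set k = {real p / (real k + 1) ^ n | n p :: nat. True} \<inter> {0<..<2}"

end

theory Submission
  imports Defs
begin

text \<open>
  Write \<open>\<beta> = k + 1\<close>. Expanding \<open>x\<close> digit by digit produces a sequence of remainders
  \<open>r 0 = x\<close>, \<open>r (i + 1) = \<beta> * r i - \<epsilon> i\<close>, and the expansions of \<open>x\<close> are exactly the digit sequences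
  read off from such a sequence that stays bounded, necessarily within \<open>[0, 2]\<close>
  (\<open>bounded_remainders_expansion\<close>, \<open>expansion_remainders\<close>). Since the base is an integer, \<open>r n\<close> and
  \<open>\<beta> ^ n * x\<close> differ by an integer; the exceptional set consists of the points for which these
  numbers eventually are integers.

  For exceptional \<open>x\<close> all late remainders lie in \<open>{0, 1, 2}\<close>. The values \<open>0\<close> and \<open>2\<close> are absorbing,
  so every remainder sequence, and hence every digit sequence, is eventually constant: there are
  only countably many. There are infinitely many because the remainders can be kept inside
  \<open>(0, 2)\<close>, where they reach \<open>1\<close>; from then on one may stay at \<open>1\<close> for as long as one likes
  before dropping to \<open>0\<close>.

  For the other points the reflection \<open>x \<mapsto> 2 - x\<close> reduces to \<open>x < 1\<close>. The ordinary base \<open>k + 1\<close>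
  expansion \<open>a\<close> of \<open>x\<close> only uses digits up to \<open>k\<close>, and a unit of place \<open>i\<close> can be exchanged for
  \<open>k + 1\<close> units of place \<open>i + 1\<close> whenever \<open>a i > 0\<close> and \<open>a (i + 1) < k\<close>. Such places exist
  arbitrarily far out, for otherwise \<open>a\<close> would end in \<open>0\<close>s or in \<open>k\<close>s: the former makes \<open>x\<close>
  exceptional, the latter contradicts that the remainders of \<open>a\<close> are fractional parts. These exchanges can be
  carried out independently of each other, one expansion for each subset of an infinite set
  (\<open>uncountable_expansions_by_borrowing\<close>).
\<close>

section \<open>Expansions as bounded remainder sequences\<close>

lemma constant_digits_sums:
  fixes \<beta> c :: real
  assumes "\<beta> > 1"
  shows "(\<lambda>i. c / \<beta> ^ Suc i) sums (c / (\<beta> - 1))"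
proof -
  have "(\<lambda>i. (1 / \<beta>) ^ i) sums (1 / (1 - 1 / \<beta>))"
    using assms by (intro geometric_sums) auto
  from sums_mult[OF this, of "c / \<beta>"]
  have "(\<lambda>i. c / \<beta> * (1 / \<beta>) ^ i) sums (c / \<beta> * (1 / (1 - 1 / \<beta>)))" .
  moreover have "c / \<beta> * (1 / (1 - 1 / \<beta>)) = c / (\<beta> - 1)"
    using assms by (simp add: field_simps)
  moreover have "(\<lambda>i. c / \<beta> * (1 / \<beta>) ^ i) = (\<lambda>i. c / \<beta> ^ Suc i)"
    by (simp add: power_divide)
  ultimately show ?thesis
    by (simp only:)
qed

text \<open>The partial sums telescope: after \<open>n\<close> digits they miss \<open>x\<close> by \<open>r n / \<beta> ^ n\<close>.\<close>

lemma bounded_remainders_expansion: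
  fixes \<beta> x C :: real
  assumes "\<beta> > 1"
    and "r 0 = x"
    and bound: "\<And>i. \<bar>r i\<bar> \<le> C"
    and digit: "\<And>i. real (\<epsilon> i) = \<beta> * r i - r (Suc i)"
    and "\<And>i. \<epsilon> i \<le> m"
  shows "\<epsilon> \<in> expansions \<beta> m x"
proof -
  have partial: "(\<Sum>i<n. real (\<epsilon> i) / \<beta> ^ Suc i) = x - r n / \<beta> ^ n" for n
  proof (induction n)
    case (Suc n)
    have "real (\<epsilon> n) / \<beta> ^ Suc n = r n / \<beta> ^ n - r (Suc n) / \<beta> ^ Suc n"
      using \<open>\<beta> > 1\<close> by (simp add: digit diff_divide_distrib)
    with Suc.IH show ?case
      by simp
  qed (use \<open>r 0 = x\<close> in simp)
  have "(\<lambda>n. (1 / \<beta>) ^ n) \<longlonglongrightarrow> 0"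
    using \<open>\<beta> > 1\<close> by (intro LIMSEQ_power_zero) auto
  moreover have "norm (r n / \<beta> ^ n) \<le> norm ((1 / \<beta>) ^ n) * C" for n
    using \<open>\<beta> > 1\<close> bound[of n] by (simp add: power_divide divide_right_mono)
  ultimately have "(\<lambda>n. r n / \<beta> ^ n) \<longlonglongrightarrow> 0"
    by (auto intro!: always_eventually elim: tendsto_0_le[where K = C])
  then have "(\<lambda>n. x - r n / \<beta> ^ n) \<longlonglongrightarrow> x - 0"
    by (intro tendsto_diff tendsto_const)
  then show ?thesis
    using assms(5) by (simp add: expansions_def sums_def partial del: power_Suc)
qed

text \<open>The remainder \<open>r n\<close> is the value of the expansion that is left after deleting \<open>n\<close> digits,
  hence it lies between the values of the constant digit sequences \<open>0\<close> and \<open>m\<close>.\<close>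

lemma expansion_remainders:
  fixes \<beta> x :: real
  assumes "\<beta> > 1" and "\<epsilon> \<in> expansions \<beta> m x"
  obtains r where "r 0 = x"
    and "\<And>i. 0 \<le> r i \<and> r i \<le> real m / (\<beta> - 1)"
    and "\<And>i. real (\<epsilon> i) = \<beta> * r i - r (Suc i)"
proof
  let ?r = "\<lambda>n. \<beta> ^ n * (x - (\<Sum>i<n. real (\<epsilon> i) / \<beta> ^ Suc i))"
  from assms have le: "\<And>i. \<epsilon> i \<le> m" and sums: "(\<lambda>i. real (\<epsilon> i) / \<beta> ^ Suc i) sums x"
    by (auto simp: expansions_def)
  show "?r 0 = x"
    by simp
  show "real (\<epsilon> i) = \<beta> * ?r i - ?r (Suc i)" for i
    using \<open>\<beta> > 1\<close> by (simp add: field_simps)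
  show "0 \<le> ?r n \<and> ?r n \<le> real m / (\<beta> - 1)" for n
  proof -
    have "(\<lambda>i. \<beta> ^ n * (real (\<epsilon> (i + n)) / \<beta> ^ Suc (i + n))) sums ?r n"
      by (intro sums_mult sums_split_initial_segment[OF sums])
    moreover have "\<beta> ^ n * (real (\<epsilon> (i + n)) / \<beta> ^ Suc (i + n)) = real (\<epsilon> (i + n)) / \<beta> ^ Suc i" for i
      using \<open>\<beta> > 1\<close> by (simp add: power_add)
    ultimately have tail: "(\<lambda>i. real (\<epsilon> (i + n)) / \<beta> ^ Suc i) sums ?r n"
      by simp
    have "0 \<le> ?r n"
      by (rule sums_le[OF _ sums_zero tail]) (use \<open>\<beta> > 1\<close> in auto)
    moreover have "?r n \<le> real m / (\<beta> - 1)"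
      by (rule sums_le[OF _ tail constant_digits_sums])
         (use \<open>\<beta> > 1\<close> le in \<open>auto intro!: divide_right_mono\<close>)
    ultimately show ?thesis
      by blast
  qed
qed

lemma reflected_expansion:
  fixes \<beta> x :: real
  assumes "\<beta> > 1" and "\<epsilon> \<in> expansions \<beta> m x"
  shows "(\<lambda>i. m - \<epsilon> i) \<in> expansions \<beta> m (real m / (\<beta> - 1) - x)"
proof -
  from assms have le: "\<And>i. \<epsilon> i \<le> m" and sums: "(\<lambda>i. real (\<epsilon> i) / \<beta> ^ Suc i) sums x"
    by (auto simp: expansions_def)
  from sums_diff[OF constant_digits_sums[OF \<open>\<beta> > 1\<close>] sums] show ?thesis
    using le by (simp add: expansions_def of_nat_diff diff_divide_distrib)
qed

lemma countable_expansions_reflect: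
  fixes \<beta> x :: real
  assumes "\<beta> > 1" and "countable (expansions \<beta> m x)"
  shows "countable (expansions \<beta> m (real m / (\<beta> - 1) - x))"
proof (rule countable_subset)
  show "expansions \<beta> m (real m / (\<beta> - 1) - x) \<subseteq> (\<lambda>\<epsilon> i. m - \<epsilon> i) ` expansions \<beta> m x"
  proof
    fix \<epsilon> assume \<epsilon>: "\<epsilon> \<in> expansions \<beta> m (real m / (\<beta> - 1) - x)"
    then have "\<epsilon> = (\<lambda>i. m - (m - \<epsilon> i))"
      by (auto simp: expansions_def)
    moreover have "(\<lambda>i. m - \<epsilon> i) \<in> expansions \<beta> m x"
      using reflected_expansion[OF \<open>\<beta> > 1\<close> \<epsilon>] by simp
    ultimately show "\<epsilon> \<in> (\<lambda>\<epsilon> i. m - \<epsilon> i) ` expansions \<beta> m x"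
      by (rule image_eqI)
  qed
qed (use assms(2) in simp)

section \<open>The exceptional set\<close>

lemma exceptional_set_iff:
  assumes "0 < x" and "x < 2"
  shows "x \<in> exceptional_set k \<longleftrightarrow> (\<exists>n. (real k + 1) ^ n * x \<in> \<int>)"
proof
  assume "x \<in> exceptional_set k"
  then obtain p n where "x = real p / (real k + 1) ^ n"
    by (auto simp: exceptional_set_def)
  then have "(real k + 1) ^ n * x = real p"
    by (simp add: field_simps)
  then show "\<exists>n. (real k + 1) ^ n * x \<in> \<int>"
    by (metis Ints_of_nat)
next
  assume "\<exists>n. (real k + 1) ^ n * x \<in> \<int>"
  then obtain n z where z: "(real k + 1) ^ n * x = of_int z"
    by (auto elim: Ints_cases)
  moreover have "0 \<le> (real k + 1) ^ n * x"
    using \<open>0 < x\<close> by simp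
  ultimately have "real (nat z) = (real k + 1) ^ n * x"
    by simp
  then have "x = real (nat z) / (real k + 1) ^ n"
    by (simp add: field_simps)
  then have "\<exists>n p. x = real p / (real k + 1) ^ n"
    by blast
  then show "x \<in> exceptional_set k"
    using assms by (simp add: exceptional_set_def)
qed

lemma remainder_congruent:
  fixes r :: "nat \<Rightarrow> real"
  assumes "\<And>i. (real k + 1) * r i - r (Suc i) \<in> \<int>"
  shows "(real k + 1) ^ n * r 0 - r n \<in> \<int>"
proof (induction n)
  case (Suc n)
  have "(real k + 1) ^ Suc n * r 0 - r (Suc n)
      = (real k + 1) * ((real k + 1) ^ n * r 0 - r n) + ((real k + 1) * r n - r (Suc n))"
    by (simp add: algebra_simps)
  also have "\<dots> \<in> \<int>"
    using Suc.IH assms by (intro Ints_add Ints_mult) auto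
  finally show ?case .
qed simp

text \<open>The base being an integer, remainders that are once integral remain so.\<close>

lemma exceptional_remainders_integral:
  assumes "x \<in> exceptional_set k" and "r 0 = x"
    and int: "\<And>i. (real k + 1) * r i - r (Suc i) \<in> \<int>"
  obtains n where "\<And>i. n \<le> i \<Longrightarrow> r i \<in> \<int>"
proof -
  from assms(1) have "0 < x" "x < 2"
    by (auto simp: exceptional_set_def)
  with assms(1) obtain n where "(real k + 1) ^ n * x \<in> \<int>"
    using exceptional_set_iff by blast
  then have base: "r n \<in> \<int>"
    using Ints_diff[OF _ remainder_congruent[of k r n, OF int]] \<open>r 0 = x\<close> by fastforce
  have "r i \<in> \<int>" if "n \<le> i" for i
    using that
  proof (induction i rule: dec_induct)
    case (step i)
    have "r (Suc i) = (real k + 1) * r i - ((real k + 1) * r i - r (Suc i))"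
      by simp
    also have "\<dots> \<in> \<int>"
      using step.IH by (intro Ints_diff[OF Ints_mult int]) auto
    finally show ?case .
  qed (rule base)
  then show thesis
    by (rule that)
qed

section \<open>Exceptional points have countably many expansions\<close>

lemma countable_eventually_constant:
  "countable {\<epsilon> :: nat \<Rightarrow> 'a :: countable. \<exists>N c. \<forall>i\<ge>N. \<epsilon> i = c}"
proof (rule countable_subset)
  let ?f = "\<lambda>(xs :: 'a list, c :: 'a) i. if i < length xs then xs ! i else c"
  show "{\<epsilon>. \<exists>N c. \<forall>i\<ge>N. \<epsilon> i = c} \<subseteq> range ?f"
  proof
    fix \<epsilon> :: "nat \<Rightarrow> 'a" assume "\<epsilon> \<in> {\<epsilon>. \<exists>N c. \<forall>i\<ge>N. \<epsilon> i = c}"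
    then obtain N c where "\<forall>i\<ge>N. \<epsilon> i = c"
      by blast
    then have "\<epsilon> = ?f (map \<epsilon> [0..<N], c)"
      by auto
    then show "\<epsilon> \<in> range ?f"
      by blast
  qed
qed simp

text \<open>A remainder \<open>0\<close> forces the digit \<open>0\<close> and a remainder \<open>2\<close> forces the digit \<open>2 * k\<close>, so an
  integral sequence of remainders either stays at \<open>1\<close> or is absorbed by one of the end points.\<close>

lemma exceptional_expansion_eventually_constant:
  assumes "k \<ge> 1" and "x \<in> exceptional_set k" and \<epsilon>: "\<epsilon> \<in> expansions (real k + 1) (2 * k) x"
  shows "\<exists>N c. \<forall>i\<ge>N. \<epsilon> i = c"
proof -
  from \<open>k \<ge> 1\<close> have "real k + 1 > 1"
    by simp
  from expansion_remainders[OF this \<epsilon>] obtain r where "r 0 = x"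
    and bounds: "\<And>i. 0 \<le> r i \<and> r i \<le> 2"
    and digit: "\<And>i. real (\<epsilon> i) = (real k + 1) * r i - r (Suc i)"
    using \<open>k \<ge> 1\<close> by auto
  from digit have "(real k + 1) * r i - r (Suc i) \<in> \<int>" for i
    by (metis Ints_of_nat)
  from exceptional_remainders_integral[of x k r, OF assms(2) \<open>r 0 = x\<close> this] obtain n
    where integral: "\<And>i. n \<le> i \<Longrightarrow> r i \<in> \<int>"
    by blast
  have cases: "r i = 0 \<or> r i = 1 \<or> r i = 2" if i: "n \<le> i" for i
  proof -
    obtain z where z: "r i = of_int z"
      using integral[OF i] by (auto elim: Ints_cases)
    with bounds[of i] have "0 \<le> z" "z \<le> 2"
      by auto
    then have "z = 0 \<or> z = 1 \<or> z = 2"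
      by arith
    with z show ?thesis
      by auto
  qed
  have le: "\<epsilon> i \<le> 2 * k" for i
    using \<epsilon> by (auto simp: expansions_def)
  have "\<exists>N v. \<forall>i\<ge>N. r i = v"
  proof (cases "\<forall>i\<ge>n. r i = 1")
    case False
    then obtain N where N: "N \<ge> n" "r N = 0 \<or> r N = 2"
      using cases by blast
    have step: "r (Suc i) = r i" if "r i = 0 \<or> r i = 2" for i
      using that
    proof
      assume "r i = 0"
      then show ?thesis
        using digit[of i] bounds[of "Suc i"] by simp
    next
      assume "r i = 2"
      moreover have "real (\<epsilon> i) \<le> 2 * real k"
        using le[of i] by linarith
      ultimately show ?thesis
        using digit[of i] bounds[of "Suc i"] by simp
    qed
    have "r i = r N" if "i \<ge> N" for i
      using that by (induction i rule: dec_induct) (use step N in auto)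
    then show ?thesis
      by blast
  qed blast
  then obtain N v where "\<And>i. i \<ge> N \<Longrightarrow> r i = v"
    by blast
  then have "real (\<epsilon> i) = (real k + 1) * v - v" if "i \<ge> N" for i
    using digit[of i] that by simp
  then have "\<epsilon> i = \<epsilon> N" if "i \<ge> N" for i
    using that by (metis of_nat_eq_iff order_refl)
  then show ?thesis
    by blast
qed

text \<open>From \<open>r\<close> in \<open>(0, 2)\<close> the digits lead to the points \<open>(k + 1) * r - d\<close> with \<open>d \<le> 2 * k\<close>. These
  have spacing \<open>1\<close>, range from a positive number down to one below \<open>2\<close>, and so hit the open
  interval \<open>(0, 2)\<close>, which has length \<open>2\<close>.\<close>

lemma interior_remainders:
  assumes "k \<ge> 1" and "0 < x" and "x < 2"
  obtains r a where "r 0 = x"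
    and "\<And>i. 0 < r i \<and> r i < 2"
    and "\<And>i. real (a i) = (real k + 1) * r i - r (Suc i)"
    and "\<And>i. a i \<le> 2 * k"
proof -
  let ?P = "\<lambda>i r. (i = 0 \<longrightarrow> r = x) \<and> 0 < r \<and> r < 2"
  let ?Q = "\<lambda>r r'. \<exists>d\<le>2 * k. real d = (real k + 1) * r - r'"
  have "\<exists>r. \<forall>i. ?P i (r i) \<and> ?Q (r i) (r (Suc i))"
  proof (rule dependent_nat_choice)
    show "\<exists>r. ?P 0 r"
      using assms by blast
    fix r :: real and i :: nat
    assume "?P i r"
    then have r: "0 < r" "r < 2"
      by auto
    \<comment> \<open>The largest admissible digit that leaves a positive remainder.\<close>
    define d where "d = min (2 * k) (nat (\<lceil>(real k + 1) * r\<rceil> - 1))"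
    have pos: "0 < (real k + 1) * r"
      using r by simp
    have "(real k + 1) * r < (real k + 1) * 2"
      using r by (intro mult_strict_left_mono) auto
    then have less: "(real k + 1) * r - real (2 * k) < 2"
      by simp
    have nat: "real (nat (\<lceil>(real k + 1) * r\<rceil> - 1)) = of_int \<lceil>(real k + 1) * r\<rceil> - 1"
      using pos by simp
    have "real d < (real k + 1) * r"
      unfolding d_def of_nat_min nat using ceiling_correct[of "(real k + 1) * r"] by linarith
    moreover have "(real k + 1) * r - real d < 2"
      unfolding d_def of_nat_min nat
      using less le_of_int_ceiling[of "(real k + 1) * r"] by linarith
    moreover have "d \<le> 2 * k"
      by (simp add: d_def)
    ultimately show "\<exists>r'. ?P (Suc i) r' \<and> ?Q r r'"
      by (intro exI[of _ "(real k + 1) * r - real d"]) auto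
  qed
  then obtain r where "\<forall>i. ?P i (r i) \<and> ?Q (r i) (r (Suc i))" ..
  then show thesis
    using that[of r] by metis
qed

text \<open>Once the remainder is constantly \<open>1\<close>, the digit \<open>k + 1\<close> may be used at any place \<open>N\<close>
  to drop to the remainder \<open>0\<close>.\<close>

lemma infinite_exceptional_expansions:
  assumes "k \<ge> 1" and "x \<in> exceptional_set k"
  shows "infinite (expansions (real k + 1) (2 * k) x)"
proof -
  from assms(2) have "0 < x" "x < 2"
    by (auto simp: exceptional_set_def)
  from interior_remainders[OF \<open>k \<ge> 1\<close> this] obtain r a where "r 0 = x"
    and bounds: "\<And>i. 0 < r i \<and> r i < 2"
    and digit: "\<And>i. real (a i) = (real k + 1) * r i - r (Suc i)"
    and le: "\<And>i. a i \<le> 2 * k"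
    by blast
  from digit have "(real k + 1) * r i - r (Suc i) \<in> \<int>" for i
    by (metis Ints_of_nat)
  from exceptional_remainders_integral[of x k r, OF assms(2) \<open>r 0 = x\<close> this] obtain n
    where integral: "\<And>i. n \<le> i \<Longrightarrow> r i \<in> \<int>"
    by blast
  have one: "r i = 1" if i: "n \<le> i" for i
  proof -
    obtain z where "r i = of_int z"
      using integral[OF i] by (auto elim: Ints_cases)
    with bounds[of i] show ?thesis
      by simp
  qed
  define \<epsilon> where "\<epsilon> N i = (if i < n + N then a i else if i = n + N then k + 1 else 0)" for N i
  have "\<epsilon> N \<in> expansions (real k + 1) (2 * k) x" for N
  proof (rule bounded_remainders_expansion)
    let ?r = "\<lambda>i. if i \<le> n + N then r i else 0"
    show "?r 0 = x"
      using \<open>r 0 = x\<close> by simp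
    show "\<bar>?r i\<bar> \<le> 2" for i
      using bounds[of i] by simp
    show "real (\<epsilon> N i) = (real k + 1) * ?r i - ?r (Suc i)" for i
      using digit[of i] one[of i] by (cases i "n + N" rule: linorder_cases) (simp_all add: \<epsilon>_def)
    show "\<epsilon> N i \<le> 2 * k" for i
      using le[of i] \<open>k \<ge> 1\<close> by (simp add: \<epsilon>_def)
  qed (use \<open>k \<ge> 1\<close> in simp)
  then have "range \<epsilon> \<subseteq> expansions (real k + 1) (2 * k) x"
    by blast
  moreover have "inj \<epsilon>"
  proof (rule linorder_injI)
    fix M N :: nat assume "M < N"
    then have "\<epsilon> M (n + N) \<noteq> \<epsilon> N (n + N)"
      by (simp add: \<epsilon>_def)
    then show "\<epsilon> M \<noteq> \<epsilon> N"
      by metis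
  qed
  ultimately show ?thesis
    using range_inj_infinite infinite_super by blast
qed

section \<open>All other points have uncountably many expansions\<close>

lemma uncountable_Pow:
  assumes "infinite P"
  shows "uncountable (Pow P)"
proof
  assume "countable (Pow P)"
  then have "Pow P \<lesssim> (UNIV :: nat set)"
    by (auto simp: countable_def lepoll_def)
  also have "(UNIV :: nat set) \<lesssim> P"
    using assms by (simp add: infinite_le_lepoll)
  finally have "P \<approx> Pow P"
    by (intro lepoll_antisym lepoll_Pow_self)
  then show False
    using Cantors_theorem[of P] by (auto simp: eqpoll_def bij_betw_def)
qed

text \<open>For each set \<open>S\<close> of admissible places, one unit of every place \<open>i \<in> S\<close> is exchanged for
  \<open>k + 1\<close> units of place \<open>i + 1\<close>. This adds the number \<open>c S i \<in> {0, 1}\<close> to the remainder \<open>r i\<close>.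
  Exchanges at neighbouring places are compatible: a digit below \<open>k\<close> can absorb \<open>k + 1\<close> units
  and a positive digit can give one away, whether or not the other happens as well. The expansion
  determines \<open>S\<close>, because \<open>c S 0 = 0\<close> and the digit at \<open>i\<close> yields \<open>c S (i + 1)\<close> from \<open>c S i\<close>.\<close>

lemma uncountable_expansions_by_borrowing:
  fixes r :: "nat \<Rightarrow> real" and a :: "nat \<Rightarrow> nat"
  assumes "k \<ge> 1" and "r 0 = x"
    and bound: "\<And>i. \<bar>r i\<bar> \<le> C"
    and digit: "\<And>i. real (a i) = (real k + 1) * r i - r (Suc i)"
    and le: "\<And>i. a i \<le> k"
    and inf: "infinite {i. a i > 0 \<and> a (Suc i) < k}"
  shows "uncountable (expansions (real k + 1) (2 * k) x)"
proof -
  define P where "P = {i. a i > 0 \<and> a (Suc i) < k}"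
  define c :: "nat set \<Rightarrow> nat \<Rightarrow> nat"
    where "c S i = (case i of 0 \<Rightarrow> 0 | Suc j \<Rightarrow> of_bool (j \<in> S))" for S i
  define \<epsilon> where "\<epsilon> S i = a i + (k + 1) * c S i - c S (Suc i)" for S i
  have c_le: "c S i \<le> 1" for S i
    by (simp add: c_def split: nat.split)
  have give: "c S (Suc i) \<le> a i" if "S \<subseteq> P" for S i
    using that by (auto simp: c_def P_def)
  have \<epsilon>_add: "\<epsilon> S i + c S (Suc i) = a i + (k + 1) * c S i" if "S \<subseteq> P" for S i
    using give[OF that, of i] by (simp add: \<epsilon>_def)
  have "\<epsilon> S \<in> expansions (real k + 1) (2 * k) x" if S: "S \<subseteq> P" for S
  proof (rule bounded_remainders_expansion)
    let ?r = "\<lambda>i. r i + real (c S i)"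
    show "?r 0 = x"
      using \<open>r 0 = x\<close> by (simp add: c_def)
    show "\<bar>?r i\<bar> \<le> C + 1" for i
      using bound[of i] c_le[of S i] by linarith
    show "real (\<epsilon> S i) = (real k + 1) * ?r i - ?r (Suc i)" for i
    proof -
      have "real (\<epsilon> S i + c S (Suc i)) = real (a i + (k + 1) * c S i)"
        by (simp only: \<epsilon>_add[OF S])
      then show ?thesis
        using digit[of i] by (simp add: algebra_simps)
    qed
    show "\<epsilon> S i \<le> 2 * k" for i
    proof (cases "c S i = 0")
      case True
      then show ?thesis
        using le[of i] by (simp add: \<epsilon>_def)
    next
      case False
      then obtain j where "i = Suc j" "j \<in> S"
        by (auto simp: c_def split: nat.splits)
      then have "a i < k" "c S i = 1"
        using S by (auto simp: P_def c_def)
      then show ?thesis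
        by (simp add: \<epsilon>_def)
    qed
  qed (use \<open>k \<ge> 1\<close> in simp)
  then have "\<epsilon> ` Pow P \<subseteq> expansions (real k + 1) (2 * k) x"
    by blast
  moreover have "inj_on \<epsilon> (Pow P)"
  proof (rule inj_onI)
    fix S T assume ST: "S \<in> Pow P" "T \<in> Pow P" and eq: "\<epsilon> S = \<epsilon> T"
    have "c S i = c T i" for i
    proof (induction i)
      case 0
      show ?case
        by (simp add: c_def)
    next
      case (Suc i)
      then show ?case
        using \<epsilon>_add[of S i] \<epsilon>_add[of T i] ST eq by simp
    qed
    then have "c S (Suc j) = c T (Suc j)" for j .
    then have "j \<in> S \<longleftrightarrow> j \<in> T" for j
      by (simp add: c_def of_bool_eq_iff)
    then show "S = T"
      by blast
  qed
  ultimately show ?thesis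
    using inf uncountable_Pow[of P] countable_subset countable_image_inj_on
    unfolding P_def by blast
qed

text \<open>A positive bounded quantity cannot be multiplied by the same factor \<open>b > 1\<close> forever. It is
  used for \<open>r\<close> itself when the digits end in \<open>0\<close>s, and for \<open>1 - r\<close> when they end in \<open>k\<close>s.\<close>

lemma bounded_geometric_zero:
  fixes f :: "nat \<Rightarrow> real"
  assumes "b > 1"
    and bounds: "\<And>i. i \<ge> N \<Longrightarrow> 0 \<le> f i \<and> f i \<le> C"
    and step: "\<And>i. i \<ge> N \<Longrightarrow> f (Suc i) = b * f i"
  shows "f N = 0"
proof (rule ccontr)
  assume "f N \<noteq> 0"
  with bounds[of N] have pos: "f N > 0"
    by simp
  have eq: "f (N + j) = b ^ j * f N" for j
    by (induction j) (simp_all add: step)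
  obtain j where "C / f N < b ^ j"
    using real_arch_pow[OF \<open>b > 1\<close>] by blast
  then have "C < f (N + j)"
    using pos by (simp add: eq field_simps)
  with bounds[of "N + j"] show False
    by simp
qed

lemma uncountable_expansions_below_one:
  assumes "k \<ge> 1" and "0 < x" and "x < 1" and "x \<notin> exceptional_set k"
  shows "uncountable (expansions (real k + 1) (2 * k) x)"
proof -
  define b where "b = real k + 1"
  have "b > 1"
    using \<open>k \<ge> 1\<close> by (simp add: b_def)
  define r where "r i = ((\<lambda>y. frac (b * y)) ^^ i) x" for i
  define a where "a i = nat \<lfloor>b * r i\<rfloor>" for i
  have r0: "r 0 = x" and r_Suc: "r (Suc i) = frac (b * r i)" for i
    by (simp_all add: r_def)
  have bounds: "0 \<le> r i \<and> r i < 1" for i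
    using assms r0 r_Suc by (cases i) (simp_all add: frac_lt_1)
  have digit: "real (a i) = b * r i - r (Suc i)" for i
    using bounds[of i] \<open>b > 1\<close> by (simp add: a_def r_Suc frac_def)
  have le: "a i \<le> k" for i
  proof -
    have "b * r i < b * 1"
      using bounds[of i] \<open>b > 1\<close> by (intro mult_strict_left_mono) auto
    then have "real (a i) < b"
      using digit[of i] bounds[of "Suc i"] by simp
    then show ?thesis
      by (simp add: b_def)
  qed
  have nonzero: "r n \<noteq> 0" for n
  proof
    assume "r n = 0"
    moreover have "(real k + 1) * r i - r (Suc i) \<in> \<int>" for i
      using digit[of i] unfolding b_def by (metis Ints_of_nat)
    ultimately have "(real k + 1) ^ n * x \<in> \<int>"
      using remainder_congruent[of k r n] r0 by simp
    then have "x \<in> exceptional_set k"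
      using assms exceptional_set_iff[of x k] by auto
    with assms show False
      by blast
  qed
  have "infinite {i. a i > 0 \<and> a (Suc i) < k}"
  proof
    assume "finite {i. a i > 0 \<and> a (Suc i) < k}"
    then obtain N where N: "\<And>i. a i > 0 \<Longrightarrow> a (Suc i) < k \<Longrightarrow> i < N"
      by (auto simp: finite_nat_set_iff_bounded)
    have "\<exists>M\<ge>N. a M > 0"
    proof (rule ccontr)
      assume none: "\<not> (\<exists>M\<ge>N. a M > 0)"
      have "r N = 0"
      proof (rule bounded_geometric_zero[of b N r 1])
        fix i assume "i \<ge> N"
        then have "a i = 0"
          using none by auto
        then show "r (Suc i) = b * r i"
          using digit[of i] by linarith
      qed (use bounds \<open>b > 1\<close> in \<open>auto simp: less_imp_le\<close>)
      with nonzero show False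
        by blast
    qed
    then obtain M where M: "M \<ge> N" "a M > 0"
      by blast
    \<comment> \<open>Beyond \<open>N\<close> a positive digit is followed by \<open>k\<close>, which is itself positive.\<close>
    have tail: "a i = k" if "i \<ge> Suc M" for i
      using that
    proof (induction i rule: dec_induct)
      case base
      show ?case
        using N[of M] M le[of "Suc M"] by (meson le_neq_implies_less not_less)
    next
      case (step i)
      then show ?case
        using N[of i] M le[of "Suc i"] \<open>k \<ge> 1\<close> by (metis Suc_leD le_neq_implies_less le_trans not_less zero_less_one)
    qed
    have "1 - r (Suc M) = 0"
    proof (rule bounded_geometric_zero[of b "Suc M" "\<lambda>i. 1 - r i" 1])
      fix i assume "i \<ge> Suc M"
      then show "1 - r (Suc i) = b * (1 - r i)"
        using digit[of i] tail[of i] by (simp add: b_def algebra_simps)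
    qed (use bounds \<open>b > 1\<close> in \<open>auto simp: less_imp_le\<close>)
    with bounds[of "Suc M"] show False
      by simp
  qed
  then show ?thesis
    using bounds digit le \<open>k \<ge> 1\<close> r0
    by (intro uncountable_expansions_by_borrowing[of k r x 1 a])
       (auto simp: b_def abs_le_iff less_imp_le intro: order_trans[of _ 0])
qed

lemma uncountable_nonexceptional_expansions:
  assumes "k \<ge> 1" and "0 < x" and "x < 2" and "x \<notin> exceptional_set k"
  shows "uncountable (expansions (real k + 1) (2 * k) x)"
proof (cases "x < 1")
  case True
  then show ?thesis
    using assms by (intro uncountable_expansions_below_one)
next
  case False
  have nonint: "(real k + 1) ^ n * x \<notin> \<int>" for n
    using assms exceptional_set_iff[of x k] by blast
  from nonint[of 0] have "x \<noteq> 1"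
    by auto
  with False have "x > 1"
    by simp
  have "(real k + 1) ^ n * (2 - x) \<notin> \<int>" for n
  proof
    assume "(real k + 1) ^ n * (2 - x) \<in> \<int>"
    then have "(real k + 1) ^ n * 2 - (real k + 1) ^ n * (2 - x) \<in> \<int>"
      by (rule Ints_diff[rotated]) (intro Ints_mult Ints_power Ints_add, auto)
    moreover have "(real k + 1) ^ n * 2 - (real k + 1) ^ n * (2 - x) = (real k + 1) ^ n * x"
      by (simp add: algebra_simps)
    ultimately show False
      using nonint[of n] by (simp only:)
  qed
  then have "2 - x \<notin> exceptional_set k"
    using exceptional_set_iff[of "2 - x" k] \<open>x > 1\<close> \<open>x < 2\<close> by auto
  then have "uncountable (expansions (real k + 1) (2 * k) (2 - x))"
    using assms \<open>x > 1\<close> by (intro uncountable_expansions_below_one) auto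
  then show ?thesis
    using countable_expansions_reflect[of "real k + 1" "2 * k" x] \<open>k \<ge> 1\<close> by auto
qed

theorem theorem1p1:
  fixes k m :: nat and \<beta> :: real
  assumes "k \<ge> 1" and "m = 2 * k" and "\<beta> = real k + 1"
  shows "(\<forall>x \<in> exceptional_set k. expansions \<beta> m x \<approx> (UNIV :: nat set)) \<and>
         (\<forall>x \<in> {0<..<2} - exceptional_set k. uncountable (expansions \<beta> m x))"
proof (intro conjI ballI)
  fix x assume x: "x \<in> exceptional_set k"
  have "expansions \<beta> m x \<subseteq> {\<epsilon>. \<exists>N c. \<forall>i\<ge>N. \<epsilon> i = c}"
    using exceptional_expansion_eventually_constant[OF \<open>k \<ge> 1\<close> x] assms by blast
  then have "countable (expansions \<beta> m x)"
    using countable_eventually_constant by (rule countable_subset)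
  moreover have "infinite (expansions \<beta> m x)"
    using infinite_exceptional_expansions[OF \<open>k \<ge> 1\<close> x] assms by simp
  ultimately show "expansions \<beta> m x \<approx> (UNIV :: nat set)"
    unfolding eqpoll_def using to_nat_on_infinite by blast
next
  fix x assume "x \<in> {0<..<2} - exceptional_set k"
  then show "uncountable (expansions \<beta> m x)"
    using uncountable_nonexceptional_expansions[OF \<open>k \<ge> 1\<close>, of x] assms by simp
qed

end
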